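(* Let $a<b$ be real numbers, let $\beta\in(0,1]$, and let $f,g\in C[a,b]$ be real-valued. Suppose that $x\in C^2[a,b]$ (real-valued) is a solution of the boundary value problem $$x''(t)+g(t)(D_a^\beta x)(t)+f(t)x(t)=0,\quad t\in(a,b),\qquad x(a)=0=x(b),$$ such that $x(t)\neq 0$ for all $t\in(a,b)$. Then $$b-a<\max\left\{\int_a^{b} \frac{(s-a)^{2-\beta}}{\Gamma(2-\beta)}|g(s)|\,ds,\ \int_a^{b} \frac{(s-a)^{1-\beta}}{\Gamma(2-\beta)}(b-s)|g(s)|\,ds\right\}+\int_a^{b}(s-a)(b-s)|f(s)|\,ds.$$
   Context: The Riemann--Liouville fractional integral of order $\alpha\ge 0$ of a real function $f$ on $[a,b]$ is $(I_a^0f)(t)=f(t)$ and, for $\alpha>0$, $(I_a^\alpha f)(t)=\frac{1}{\Gamma(\alpha)}\int_a^t(t-s)^{\alpha-1}f(s)\,ds$, $t\in[a,b]$, provided the integral exists. The Riemann--Liouville fractional derivative of order $n-1<\alpha\le n$, $n\in\mathbb{N}$, is $(D_a^\alpha f)(t)=(D^nI_a^{n-\alpha}f)(t)$ with $D^n=\frac{d^n}{dt^n}$, provided the right-hand side exists. In particular, for $0<\beta\le 1$, $D_a^\beta x=\frac{d}{dt}I_a^{1-\beta}x$, and $D_a^1x=x'$. $\Gamma$ is the Gamma function. *)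

theory Defs
  imports "HOL-Analysis.Analysis"
begin

text \<open>
  Derivatives are taken within \<open>S\<close>, so for \<open>S = {a..b}\<close> they are one-sided at the endpoints;
  \<open>C_on n {a..b}\<close> is the space $C^n[a,b]$.
\<close>

primrec C_on :: "nat \<Rightarrow> real set \<Rightarrow> (real \<Rightarrow> real) \<Rightarrow> bool" where
  "C_on 0 S f \<longleftrightarrow> continuous_on S f"
| "C_on (Suc n) S f \<longleftrightarrow>
     (\<exists>f'. (\<forall>t\<in>S. (f has_real_derivative f' t) (at t within S)) \<and> C_on n S f')"

text \<open>
  The library's \<open>integral\<close> and \<open>deriv\<close> are total, so the provisos on the existence of the
  Riemann--Liouville integral and derivative are separate predicates.
  The kernel takes the value \<open>0\<close> at \<open>s = t\<close>, which does not affect the integral.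
\<close>

definition RL_integral :: "real \<Rightarrow> real \<Rightarrow> (real \<Rightarrow> real) \<Rightarrow> real \<Rightarrow> real" where
  "RL_integral \<alpha> a f t =
     (if \<alpha> = 0 then f t
      else 1 / Gamma \<alpha> * integral {a..t} (\<lambda>s. (t - s) powr (\<alpha> - 1) * f s))"

definition RL_integral_exists :: "real \<Rightarrow> real \<Rightarrow> (real \<Rightarrow> real) \<Rightarrow> real \<Rightarrow> bool" where
  "RL_integral_exists \<alpha> a f t \<longleftrightarrow>
     \<alpha> = 0 \<or> (\<lambda>s. (t - s) powr (\<alpha> - 1) * f s) integrable_on {a..t}"

primrec nth_differentiable_at :: "nat \<Rightarrow> (real \<Rightarrow> real) \<Rightarrow> real \<Rightarrow> bool" where
  "nth_differentiable_at 0 F t \<longleftrightarrow> True"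
| "nth_differentiable_at (Suc n) F t \<longleftrightarrow>
     (\<forall>\<^sub>F s in nhds t. nth_differentiable_at n F s) \<and>
     (deriv ^^ n) F field_differentiable (at t)"

text \<open>
  For \<open>\<alpha> > 0\<close>, \<open>nat \<lceil>\<alpha>\<rceil>\<close> is the \<open>n\<close> with \<open>n - 1 < \<alpha> \<le> n\<close>. Derivatives are
  two-sided, so these definitions are meant for interior points of the interval.
\<close>

definition RL_derivative :: "real \<Rightarrow> real \<Rightarrow> (real \<Rightarrow> real) \<Rightarrow> real \<Rightarrow> real" where
  "RL_derivative \<alpha> a f t =
     (let n = nat \<lceil>\<alpha>\<rceil> in (deriv ^^ n) (RL_integral (real n - \<alpha>) a f) t)"

definition RL_derivative_exists :: "real \<Rightarrow> real \<Rightarrow> (real \<Rightarrow> real) \<Rightarrow> real \<Rightarrow> bool" where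
  "RL_derivative_exists \<alpha> a f t \<longleftrightarrow>
     (let n = nat \<lceil>\<alpha>\<rceil> in
        (\<forall>\<^sub>F s in nhds t. RL_integral_exists (real n - \<alpha>) a f s) \<and>
        nth_differentiable_at n (RL_integral (real n - \<alpha>) a f) t)"

end

theory Submission imports Defs begin

text \<open>
  Let \<open>M\<close> be the maximum of \<open>\<bar>x'\<bar>\<close> on \<open>{a..b}\<close>, attained at \<open>t\<close>.  The Dirichlet conditions express
  the slope by the curvature (\<open>green_representation_of_derivative\<close>): \<open>(b - a) * x' t\<close> is the integral of \<open>(s - a) * x'' s\<close> over
  \<open>{a..t}\<close> minus the integral of \<open>(b - s) * x'' s\<close> over \<open>{t..b}\<close>.

  The differential equation bounds the curvature in terms of \<open>M\<close>.  Since \<open>x\<close> vanishes at both ends,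
  \<open>\<bar>x s\<bar> \<le> M * (s - a)\<close> and \<open>\<bar>x s\<bar> \<le> M * (b - s)\<close>; and since \<open>x a = 0\<close>, the fractional derivative
  is at most \<open>M\<close> times that of \<open>s - a\<close>, which is \<open>(s - a) powr (1 - \<beta>) / Gamma (2 - \<beta>)\<close>
  (\<open>RL_derivative_bound\<close>).  Inserting these bounds gives \<open>(b - a) * M\<close> on the left, and on the right
  \<open>M\<close> times the weighted integral of \<open>\<bar>f\<bar>\<close> plus \<open>M\<close> times a term in \<open>\<bar>g\<bar>\<close> that depends on \<open>t\<close>.  That
  term is largest when \<open>t\<close> is an endpoint (\<open>glued_moment_le_max\<close>), which accounts for the maximum
  in the conclusion.

  Strictness has one source.  If \<open>x'' s\<close> is nonzero at an interior point, then \<open>x'\<close> has no extremum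
  there, so \<open>\<bar>x' s\<bar> < M\<close>, and all three bounds above are strict at \<open>s\<close>.  Thus the integrands are
  strictly dominated wherever the curvature is nonzero, and the curvature cannot vanish identically
  because \<open>M > 0\<close>.
\<close>

section \<open>Slopes and increments\<close>

text \<open>
  If \<open>x d - x c\<close> had modulus \<open>M * (d - c)\<close>, then \<open>M - y\<close> or \<open>M + y\<close> would be a nonnegative
  continuous function with vanishing integral, so \<open>\<bar>y\<bar> = M\<close> on all of \<open>{c..d}\<close>.
\<close>

lemma increment_less_of_derivative_less:
  fixes x y :: "real \<Rightarrow> real"
  assumes der: "\<And>s. s \<in> {a..b} \<Longrightarrow> (x has_real_derivative y s) (at s within {a..b})"
    and cont: "continuous_on {a..b} y"
    and bound: "\<And>s. s \<in> {a..b} \<Longrightarrow> \<bar>y s\<bar> \<le> M"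
    and sub: "a \<le> c" "c < d" "d \<le> b"
    and s0: "s0 \<in> {c..d}" "\<bar>y s0\<bar> < M"
  shows "\<bar>x d - x c\<bar> < M * (d - c)"
proof -
  have "(y has_integral (x d - x c)) {c..d}"
  proof (rule fundamental_theorem_of_calculus)
    fix s assume "s \<in> {c..d}"
    then show "(x has_vector_derivative y s) (at s within {c..d})"
      using has_field_derivative_subset[OF der[of s], of "{c..d}"] sub
      by (auto simp: has_real_derivative_iff_has_vector_derivative)
  qed (use sub in simp)
  then have int: "((\<lambda>s. M - \<sigma> * y s) has_integral (M * (d - c) - \<sigma> * (x d - x c))) {c..d}" for \<sigma>
    using sub by (intro has_integral_diff has_integral_mult_right)
      (use has_integral_const_real[of M c d] in \<open>simp add: mult.commute\<close>)
  \<comment> \<open>The sign \<open>\<sigma>\<close> treats the upper and the lower bound at once.\<close>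
  have pos: "0 < M * (d - c) - \<sigma> * (x d - x c)" if \<sigma>: "\<bar>\<sigma>\<bar> = 1" for \<sigma>
  proof -
    have le: "\<sigma> * y s \<le> \<bar>y s\<bar>" for s
      using \<sigma> by (metis abs_ge_self abs_mult mult_1)
    have nonneg: "0 \<le> M - \<sigma> * y s" if "s \<in> {c..d}" for s
      using le[of s] bound[of s] that sub by auto
    have c1: "continuous_on {c..d} (\<lambda>s. M - \<sigma> * y s)"
      using sub by (intro continuous_intros continuous_on_subset[OF cont]) auto
    have "integral {c..d} (\<lambda>s. M - \<sigma> * y s) \<noteq> 0"
      using integral_eq_0_iff[OF c1 \<open>c < d\<close> nonneg] s0 le[of s0] by fastforce
    moreover have "0 \<le> integral {c..d} (\<lambda>s. M - \<sigma> * y s)"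
      using nonneg int by (intro integral_nonneg) auto
    ultimately show ?thesis
      using int[of \<sigma>] by (simp add: has_integral_iff)
  qed
  show ?thesis
    using pos[of 1] pos[of "-1"] by (simp add: abs_less_iff)
qed

text \<open>
  The square \<open>y\<^sup>2\<close> has an interior maximum at \<open>s\<close>, so \<open>2 * y s * z = 0\<close>, and \<open>y s\<close> is not zero.
  In contrapositive form: wherever \<open>x''\<close> is nonzero, the slope \<open>x'\<close> is strictly smaller than its
  maximum.
\<close>

lemma derivative_eq_zero_at_interior_abs_max:
  fixes y :: "real \<Rightarrow> real"
  assumes der: "(y has_real_derivative z) (at s)"
    and s: "s \<in> {a<..<b}" and bound: "\<And>r. r \<in> {a<..<b} \<Longrightarrow> \<bar>y r\<bar> \<le> M"
    and max: "\<bar>y s\<bar> = M" "0 < M"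
  shows "z = 0"
proof -
  define d where "d = min (s - a) (b - s)"
  have "((\<lambda>r. (y r)\<^sup>2) has_real_derivative 2 * y s * z) (at s)"
    using DERIV_power[OF der, of 2] by (simp add: mult_ac)
  moreover have "d > 0" using s by (auto simp: d_def)
  moreover have "(y r)\<^sup>2 \<le> (y s)\<^sup>2" if "\<bar>s - r\<bar> < d" for r
  proof -
    have "r \<in> {a<..<b}" using that by (auto simp: d_def)
    then have "\<bar>y r\<bar> \<le> \<bar>y s\<bar>" using bound max by simp
    then show ?thesis by (simp add: abs_le_square_iff)
  qed
  ultimately have "2 * y s * z = 0" by (blast intro: DERIV_local_max)
  then show ?thesis using max by auto
qed

section \<open>Interval length and curvature\<close>

text \<open>
  This carries a strict pointwise inequality through the integral when strictness is known only
  where \<open>f\<close> does not vanish: either such a point exists, or \<open>f\<close> contributes nothing at all.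
  The hypotheses stay in the open interval because the differential equation holds only there;
  continuity gives the nonstrict inequality at the endpoints.
\<close>

lemma integral_less_or_zero:
  fixes f g :: "real \<Rightarrow> real"
  assumes "c \<le> d" and cf: "continuous_on {c..d} f" and cg: "continuous_on {c..d} g"
    and nonneg: "\<And>s. s \<in> {c<..<d} \<Longrightarrow> 0 \<le> g s"
    and less: "\<And>s. s \<in> {c<..<d} \<Longrightarrow> f s \<noteq> 0 \<Longrightarrow> f s < g s"
  shows "integral {c..d} f < integral {c..d} g \<or> (integral {c..d} f = 0 \<and> 0 \<le> integral {c..d} g)"
proof (cases "c = d")
  case False
  then have "c < d" using \<open>c \<le> d\<close> by simp
  have closed_nonneg: "0 \<le> h s"
    if "continuous_on {c..d} h" "\<And>s. s \<in> {c<..<d} \<Longrightarrow> 0 \<le> h s" "s \<in> {c..d}"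
    for h :: "real \<Rightarrow> real" and s
    using continuous_ge_on_closure[of "{c<..<d}" h s 0] that \<open>c < d\<close> by simp
  have int: "f integrable_on {c..d}" "g integrable_on {c..d}"
    using cf cg by (auto intro: integrable_continuous_interval)
  have c: "continuous_on {c..d} (\<lambda>s. g s - f s)"
    using cf cg by (intro continuous_intros)
  have diff: "0 \<le> g s - f s" if "s \<in> {c..d}" for s
  proof (rule closed_nonneg[OF c _ that])
    fix r assume "r \<in> {c<..<d}"
    then show "0 \<le> g r - f r"
      using nonneg[of r] less[of r] by (cases "f r = 0") auto
  qed
  show ?thesis
  proof (cases "\<exists>s\<in>{c<..<d}. f s \<noteq> 0")
    case True
    then obtain r where r: "r \<in> {c<..<d}" "f r \<noteq> 0" by blast
    have "integral {c..d} (\<lambda>s. g s - f s) \<noteq> 0"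
    proof
      assume "integral {c..d} (\<lambda>s. g s - f s) = 0"
      then have "\<forall>s\<in>{c..d}. g s - f s = 0"
        by (subst (asm) integral_eq_0_iff[OF c \<open>c < d\<close> diff])
      then have "g r - f r = 0" using r by simp
      then show False using less[OF r] by simp
    qed
    moreover have "0 \<le> integral {c..d} (\<lambda>s. g s - f s)"
      using diff int by (intro integral_nonneg integrable_diff) auto
    ultimately show ?thesis using int by (simp add: integral_diff)
  next
    case False
    have "integral {c..d} f = integral {c..d} (\<lambda>s. 0)"
      using False by (intro integral_spike[of "{c, d}"]) auto
    moreover have "0 \<le> integral {c..d} g"
      using int closed_nonneg[OF cg nonneg] by (intro integral_nonneg) auto
    ultimately show ?thesis by simp
  qed
qed simp

text \<open>
  This is the derivative of the Green's function representation of \<open>x\<close> by \<open>x''\<close> under Dirichlet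
  conditions.  It follows at once from the primitives \<open>(s - a) * y s - x s\<close> and
  \<open>(b - s) * y s + x s\<close> of the two integrands.
\<close>

lemma green_representation_of_derivative:
  fixes x y z :: "real \<Rightarrow> real"
  assumes dx: "\<And>s. s \<in> {a..b} \<Longrightarrow> (x has_real_derivative y s) (at s within {a..b})"
    and dy: "\<And>s. s \<in> {a..b} \<Longrightarrow> (y has_real_derivative z s) (at s within {a..b})"
    and "x a = 0" "x b = 0" and t: "t \<in> {a..b}"
  shows "(b - a) * y t = integral {a..t} (\<lambda>s. (s - a) * z s) - integral {t..b} (\<lambda>s. (b - s) * z s)"
proof -
  have "((\<lambda>s. (s - a) * z s) has_integral (((t - a) * y t - x t) - ((a - a) * y a - x a))) {a..t}"
  proof (rule fundamental_theorem_of_calculus)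
    fix s assume s: "s \<in> {a..t}"
    note [derivative_intros] = has_field_derivative_subset[OF dx[of s], of "{a..t}"]
      has_field_derivative_subset[OF dy[of s], of "{a..t}"]
    show "((\<lambda>s. (s - a) * y s - x s) has_vector_derivative (s - a) * z s) (at s within {a..t})"
      unfolding has_real_derivative_iff_has_vector_derivative[symmetric]
      using s t by (auto intro!: derivative_eq_intros)
  qed (use t in simp)
  moreover have "((\<lambda>s. (b - s) * z s) has_integral (((b - b) * y b + x b) - ((b - t) * y t + x t))) {t..b}"
  proof (rule fundamental_theorem_of_calculus)
    fix s assume s: "s \<in> {t..b}"
    note [derivative_intros] = has_field_derivative_subset[OF dx[of s], of "{t..b}"]
      has_field_derivative_subset[OF dy[of s], of "{t..b}"]
    show "((\<lambda>s. (b - s) * y s + x s) has_vector_derivative (b - s) * z s) (at s within {t..b})"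
      unfolding has_real_derivative_iff_has_vector_derivative[symmetric]
      using s t by (auto intro!: derivative_eq_intros)
  qed (use t in simp)
  ultimately show ?thesis
    using assms by (simp add: has_integral_iff algebra_simps)
qed

text \<open>
  As a function of \<open>t\<close>, the left-hand side has derivative \<open>(2 * t - a - b) * p t\<close>, so it decreases
  up to the midpoint and increases afterwards; its maximum is attained at an endpoint.  The proof
  compares the weights \<open>s - a\<close> and \<open>b - s\<close> on the side of \<open>t\<close> away from the midpoint.
\<close>

lemma glued_moment_le_max:
  fixes p :: "real \<Rightarrow> real"
  assumes cont: "continuous_on {a..b} p" and nonneg: "\<And>s. s \<in> {a..b} \<Longrightarrow> 0 \<le> p s"
    and t: "t \<in> {a..b}"
  shows "integral {a..t} (\<lambda>s. (s - a) * p s) + integral {t..b} (\<lambda>s. (b - s) * p s)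
    \<le> max (integral {a..b} (\<lambda>s. (s - a) * p s)) (integral {a..b} (\<lambda>s. (b - s) * p s))"
proof -
  have int: "(\<lambda>s. (s - a) * p s) integrable_on {c..d}" "(\<lambda>s. (b - s) * p s) integrable_on {c..d}"
    if "a \<le> c" "d \<le> b" for c d
    using that by (auto intro!: integrable_continuous_interval continuous_intros
        continuous_on_subset[OF cont])
  note split = Henstock_Kurzweil_Integration.integral_combine[of a t b]
  show ?thesis
  proof (cases "t \<le> (a + b) / 2")
    case True
    have "integral {a..t} (\<lambda>s. (s - a) * p s) \<le> integral {a..t} (\<lambda>s. (b - s) * p s)"
      using t True by (intro integral_le int mult_right_mono nonneg) auto
    then show ?thesis
      using split[OF _ _ int(2)] t by (auto simp: le_max_iff_disj)
  next
    case False
    have "integral {t..b} (\<lambda>s. (b - s) * p s) \<le> integral {t..b} (\<lambda>s. (s - a) * p s)"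
      using t False by (intro integral_le int mult_right_mono nonneg) auto
    then show ?thesis
      using split[OF _ _ int(1)] t by (auto simp: le_max_iff_disj)
  qed
qed

text \<open>
  At a point \<open>t\<close> of maximal slope \<open>M\<close>, the Green representation bounds \<open>(b - a) * M\<close> by the moments
  of \<open>\<bar>z\<bar>\<close>.  The two curvature bounds are used on opposite sides of \<open>t\<close>: the one with \<open>b - s\<close> to
  the left, where the weight is \<open>s - a\<close>, and the one with \<open>s - a\<close> to the right, where the weight is
  \<open>b - s\<close>.  In both cases \<open>q\<close> receives the symmetric weight \<open>(s - a) * (b - s)\<close>, so its integrals
  over the two pieces add up to one integral over \<open>{a..b}\<close>, for every position of \<open>t\<close>.
\<close>

lemma interval_length_less_of_curvature_bound:
  fixes x y z p q :: "real \<Rightarrow> real"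
  assumes "a < b"
    and dx: "\<And>s. s \<in> {a..b} \<Longrightarrow> (x has_real_derivative y s) (at s within {a..b})"
    and dy: "\<And>s. s \<in> {a..b} \<Longrightarrow> (y has_real_derivative z s) (at s within {a..b})"
    and cont: "continuous_on {a..b} z" "continuous_on {a..b} p" "continuous_on {a..b} q"
    and bc: "x a = 0" "x b = 0"
    and nonneg: "\<And>s. s \<in> {a..b} \<Longrightarrow> 0 \<le> p s" "\<And>s. s \<in> {a..b} \<Longrightarrow> 0 \<le> q s"
    and t: "t \<in> {a..b}" "\<bar>y t\<bar> = M" "0 < M"
    and left: "\<And>s. s \<in> {a<..<b} \<Longrightarrow> z s \<noteq> 0 \<Longrightarrow> \<bar>z s\<bar> < M * (p s + q s * (s - a))"
    and right: "\<And>s. s \<in> {a<..<b} \<Longrightarrow> z s \<noteq> 0 \<Longrightarrow> \<bar>z s\<bar> < M * (p s + q s * (b - s))"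
  shows "b - a < max (integral {a..b} (\<lambda>s. (s - a) * p s)) (integral {a..b} (\<lambda>s. (b - s) * p s))
    + integral {a..b} (\<lambda>s. (s - a) * (b - s) * q s)"
proof -
  define A where "A = integral {a..t} (\<lambda>s. (s - a) * \<bar>z s\<bar>)"
  define B where "B = integral {t..b} (\<lambda>s. (b - s) * \<bar>z s\<bar>)"
  define A' where "A' = integral {a..t} (\<lambda>s. M * ((s - a) * p s + (s - a) * (b - s) * q s))"
  define B' where "B' = integral {t..b} (\<lambda>s. M * ((b - s) * p s + (s - a) * (b - s) * q s))"
  note cont_sub = cont[THEN continuous_on_subset]
  have "\<bar>integral {a..t} (\<lambda>s. (s - a) * z s)\<bar> \<le> A"
    unfolding A_def real_norm_def[symmetric]
    using t by (intro Henstock_Kurzweil_Integration.integral_norm_bound_integral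
        integrable_continuous_interval continuous_intros cont_sub) (auto simp: abs_mult)
  moreover have "\<bar>integral {t..b} (\<lambda>s. (b - s) * z s)\<bar> \<le> B"
    unfolding B_def real_norm_def[symmetric]
    using t by (intro Henstock_Kurzweil_Integration.integral_norm_bound_integral
        integrable_continuous_interval continuous_intros cont_sub) (auto simp: abs_mult)
  moreover have "(b - a) * M = \<bar>(b - a) * y t\<bar>"
    using t \<open>a < b\<close> by (simp add: abs_mult)
  moreover have "(b - a) * y t
      = integral {a..t} (\<lambda>s. (s - a) * z s) - integral {t..b} (\<lambda>s. (b - s) * z s)"
    by (rule green_representation_of_derivative[OF dx dy bc t(1)])
  ultimately have le: "(b - a) * M \<le> A + B"
    by linarith
  have A: "A < A' \<or> (A = 0 \<and> 0 \<le> A')"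
    unfolding A_def A'_def
  proof (rule integral_less_or_zero)
    fix s assume s: "s \<in> {a<..<t}"
    then show "0 \<le> M * ((s - a) * p s + (s - a) * (b - s) * q s)"
      using t nonneg by simp
    assume "(s - a) * \<bar>z s\<bar> \<noteq> 0"
    then have "(s - a) * \<bar>z s\<bar> < (s - a) * (M * (p s + q s * (b - s)))"
      using s t by (intro mult_strict_left_mono right) auto
    then show "(s - a) * \<bar>z s\<bar> < M * ((s - a) * p s + (s - a) * (b - s) * q s)"
      by (simp add: algebra_simps)
  qed (use t in \<open>auto intro!: continuous_intros cont_sub\<close>)
  have B: "B < B' \<or> (B = 0 \<and> 0 \<le> B')"
    unfolding B_def B'_def
  proof (rule integral_less_or_zero)
    fix s assume s: "s \<in> {t<..<b}"
    then show "0 \<le> M * ((b - s) * p s + (s - a) * (b - s) * q s)"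
      using t nonneg by simp
    assume "(b - s) * \<bar>z s\<bar> \<noteq> 0"
    then have "(b - s) * \<bar>z s\<bar> < (b - s) * (M * (p s + q s * (s - a)))"
      using s t by (intro mult_strict_left_mono left) auto
    then show "(b - s) * \<bar>z s\<bar> < M * ((b - s) * p s + (s - a) * (b - s) * q s)"
      by (simp add: algebra_simps)
  qed (use t in \<open>auto intro!: continuous_intros cont_sub\<close>)
  have int: "(\<lambda>s. (s - a) * p s) integrable_on {c..d}" "(\<lambda>s. (b - s) * p s) integrable_on {c..d}"
    "(\<lambda>s. (s - a) * (b - s) * q s) integrable_on {c..d}" if "a \<le> c" "d \<le> b" for c d
    using that by (auto intro!: integrable_continuous_interval continuous_intros cont_sub)
  \<comment> \<open>Both sides cannot be free of curvature, since the slope at \<open>t\<close> is nonzero.\<close>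
  have "0 < (b - a) * M" using t \<open>a < b\<close> by simp
  with le A B have "(b - a) * M < A' + B'" by linarith
  also have "A' + B' = M * ((integral {a..t} (\<lambda>s. (s - a) * p s) + integral {t..b} (\<lambda>s. (b - s) * p s))
      + (integral {a..t} (\<lambda>s. (s - a) * (b - s) * q s) + integral {t..b} (\<lambda>s. (s - a) * (b - s) * q s)))"
    unfolding A'_def B'_def Henstock_Kurzweil_Integration.integral_mult_right using t
    by (simp add: Henstock_Kurzweil_Integration.integral_add[OF int(1,3)]
        Henstock_Kurzweil_Integration.integral_add[OF int(2,3)] ring_distribs(1))
  also have "integral {a..t} (\<lambda>s. (s - a) * (b - s) * q s) + integral {t..b} (\<lambda>s. (s - a) * (b - s) * q s)
      = integral {a..b} (\<lambda>s. (s - a) * (b - s) * q s)"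
    using t int by (intro Henstock_Kurzweil_Integration.integral_combine) auto
  finally have "b - a < integral {a..t} (\<lambda>s. (s - a) * p s) + integral {t..b} (\<lambda>s. (b - s) * p s)
      + integral {a..b} (\<lambda>s. (s - a) * (b - s) * q s)"
    using t by (simp add: mult.commute)
  also have "\<dots> \<le> max (integral {a..b} (\<lambda>s. (s - a) * p s)) (integral {a..b} (\<lambda>s. (b - s) * p s))
      + integral {a..b} (\<lambda>s. (s - a) * (b - s) * q s)"
    using glued_moment_le_max[OF cont(2) nonneg(1) t(1)] by simp
  finally show ?thesis .
qed

section \<open>Fractional derivatives of functions vanishing at the base point\<close>

text \<open>
  In the coordinate \<open>u = t - s\<close> the singular kernel does not depend on \<open>t\<close>, so Riemann--Liouville
  integrals at different points can be subtracted under one integral sign.  Extending \<open>x\<close> by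
  \<open>x a = 0\<close> to the left of \<open>a\<close> makes the range of integration \<open>{0..T}\<close> independent of \<open>t\<close> as well.
\<close>

lemma has_integral_convolution_coordinate:
  fixes x :: "real \<Rightarrow> real"
  assumes int: "(\<lambda>s. (t - s) powr p * x s) integrable_on {a..t}"
    and "x a = 0" "a \<le> t" "t - a \<le> T"
  shows "((\<lambda>u. u powr p * x (max a (t - u))) has_integral
           integral {a..t} (\<lambda>s. (t - s) powr p * x s)) {0..T}" (is "(?h has_integral ?I) _")
proof -
  have "((\<lambda>s. (t - s) powr p * x s) has_integral ?I) {a..t}"
    using int by (rule integrable_integral)
  then have "((\<lambda>u. (t - - u) powr p * x (- u)) has_integral ?I) {-t..-a}"
    by (subst (asm) has_integral_reflect_real[symmetric])
  then have "((\<lambda>u. (t - - (u - t)) powr p * x (- (u - t))) has_integral ?I) {0..t - a}"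
    using has_integral_shift_real_ivl[of "\<lambda>u. (t - - u) powr p * x (- u)" ?I "-t" "-a" "-t"] by simp
  then have "(?h has_integral ?I) {0..t - a}"
    by (rule has_integral_eq[rotated]) (auto simp: max_def)
  then have "((\<lambda>u. if u \<in> {0..t - a} then ?h u else 0) has_integral ?I) {0..T}"
    using assms by (subst has_integral_restrict) auto
  then show ?thesis
    by (rule has_integral_eq[rotated]) (use assms in \<open>auto simp: max_def\<close>)
qed

text \<open>
  The difference of the two fractional integrals is the integral of the kernel against increments
  of \<open>x\<close> of step \<open>h\<close>, which are at most \<open>M * h\<close>, and at most \<open>(M - \<epsilon>) * h\<close> for the kernel
  arguments \<open>u\<close> in \<open>{0..\<delta>}\<close>.  The saving \<open>\<epsilon> * \<delta> powr \<gamma>\<close> does not depend on \<open>h\<close>, so it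
  survives the limit \<open>h \<rightarrow> 0\<close> and yields a strict inequality there.
\<close>

lemma difference_quotient_RL_integral_le:
  fixes x :: "real \<Rightarrow> real"
  assumes "0 < \<gamma>" "0 < h" "h \<le> \<delta>" "a \<le> t - \<delta>" "t + h \<le> b" "x a = 0"
    and ex: "RL_integral_exists \<gamma> a x t" "RL_integral_exists \<gamma> a x (t + h)"
    and lip: "\<And>r s. r \<in> {a..b} \<Longrightarrow> s \<in> {a..b} \<Longrightarrow> \<bar>x r - x s\<bar> \<le> M * \<bar>r - s\<bar>"
    and lip_near: "\<And>r s. r \<in> {t-\<delta>..t+h} \<Longrightarrow> s \<in> {t-\<delta>..t+h} \<Longrightarrow> \<bar>x r - x s\<bar> \<le> (M - \<epsilon>) * \<bar>r - s\<bar>"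
    and "0 \<le> M"
  shows "\<bar>(RL_integral \<gamma> a x (t + h) - RL_integral \<gamma> a x t) / h\<bar>
    \<le> (M * (t + h - a) powr \<gamma> - \<epsilon> * \<delta> powr \<gamma>) / Gamma (\<gamma> + 1)"
proof -
  define T where "T = t + h - a"
  define I where "I = (\<lambda>t. integral {a..t} (\<lambda>s. (t - s) powr (\<gamma> - 1) * x s))"
  define \<Delta> where "\<Delta> = (\<lambda>u. u powr (\<gamma> - 1) * (x (max a (t + h - u)) - x (max a (t - u))))"
  \<comment> \<open>The majorant of the integrand, with the saving near the singularity subtracted.\<close>
  define N where "N = (\<lambda>u. h * (M * u powr (\<gamma> - 1) - (if u \<in> {0..\<delta>} then \<epsilon> * u powr (\<gamma> - 1) else 0)))"
  have exI: "(\<lambda>s. (t - s) powr (\<gamma> - 1) * x s) integrable_on {a..t}"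
    "(\<lambda>s. (t + h - s) powr (\<gamma> - 1) * x s) integrable_on {a..t + h}"
    using ex \<open>0 < \<gamma>\<close> by (auto simp: RL_integral_exists_def)
  have \<Delta>: "(\<Delta> has_integral (I (t + h) - I t)) {0..T}"
    unfolding \<Delta>_def I_def right_diff_distrib
    by (intro has_integral_diff has_integral_convolution_coordinate exI) (use assms in \<open>auto simp: T_def\<close>)
  have kernel: "((\<lambda>u. u powr (\<gamma> - 1)) has_integral (c powr \<gamma> / \<gamma>)) {0..c}" if "0 \<le> c" for c
    using has_integral_powr_from_0[of "\<gamma> - 1" c] that \<open>0 < \<gamma>\<close> by simp
  have "((\<lambda>u. if u \<in> {0..\<delta>} then \<epsilon> * u powr (\<gamma> - 1) else 0) has_integral (\<epsilon> * (\<delta> powr \<gamma> / \<gamma>))) {0..T}"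
    using has_integral_mult_right[OF kernel[of \<delta>], of \<epsilon>] assms
    by (subst has_integral_restrict) (simp_all add: T_def)
  then have N: "(N has_integral (h * (M * (T powr \<gamma> / \<gamma>) - \<epsilon> * (\<delta> powr \<gamma> / \<gamma>)))) {0..T}"
    unfolding N_def using assms
    by (intro has_integral_mult_right has_integral_diff kernel) (auto simp: T_def)
  have le: "norm (\<Delta> u) \<le> N u" if u: "u \<in> {0..T}" for u
  proof -
    define r where "r = max a (t + h - u)"
    define s where "s = max a (t - u)"
    define L where "L = (if u \<le> \<delta> then M - \<epsilon> else M)"
    have "\<bar>x r - x s\<bar> \<le> L * h"
    proof (cases "u \<le> \<delta>")
      case True
      then show ?thesis
        using lip_near[of r s] u assms by (simp add: L_def r_def s_def)
    next
      case False
      have "\<bar>x r - x s\<bar> \<le> M * \<bar>r - s\<bar>"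
        using u assms by (intro lip) (auto simp: r_def s_def)
      also have "\<dots> \<le> M * h"
        using assms by (intro mult_left_mono) (auto simp: r_def s_def)
      finally show ?thesis using False by (simp add: L_def)
    qed
    then have "u powr (\<gamma> - 1) * \<bar>x r - x s\<bar> \<le> u powr (\<gamma> - 1) * (L * h)"
      by (intro mult_left_mono) auto
    moreover have "norm (\<Delta> u) = u powr (\<gamma> - 1) * \<bar>x r - x s\<bar>"
      by (simp add: \<Delta>_def r_def s_def abs_mult)
    moreover have "N u = u powr (\<gamma> - 1) * (L * h)"
      using u by (auto simp: N_def L_def algebra_simps)
    ultimately show ?thesis by simp
  qed
  have "\<bar>I (t + h) - I t\<bar> \<le> h * (M * (T powr \<gamma> / \<gamma>) - \<epsilon> * (\<delta> powr \<gamma> / \<gamma>))"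
    using Henstock_Kurzweil_Integration.integral_norm_bound_integral[of \<Delta> "{0..T}" N] \<Delta> N le
    by (auto simp: has_integral_iff)
  also have "\<dots> = h * ((M * T powr \<gamma> - \<epsilon> * \<delta> powr \<gamma>) / \<gamma>)"
    by (simp add: diff_divide_distrib)
  finally have "\<bar>I (t + h) - I t\<bar> / h \<le> (M * T powr \<gamma> - \<epsilon> * \<delta> powr \<gamma>) / \<gamma>"
    using \<open>0 < h\<close> by (simp add: pos_divide_le_eq mult.commute)
  then have "\<bar>I (t + h) - I t\<bar> / h / Gamma \<gamma> \<le> (M * T powr \<gamma> - \<epsilon> * \<delta> powr \<gamma>) / \<gamma> / Gamma \<gamma>"
    using Gamma_real_pos[OF \<open>0 < \<gamma>\<close>] by (intro divide_right_mono) auto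
  moreover have "\<bar>(RL_integral \<gamma> a x (t + h) - RL_integral \<gamma> a x t) / h\<bar> = \<bar>I (t + h) - I t\<bar> / h / Gamma \<gamma>"
    using Gamma_real_pos[OF \<open>0 < \<gamma>\<close>] \<open>0 < \<gamma>\<close> \<open>0 < h\<close>
    by (simp add: RL_integral_def I_def abs_mult diff_divide_distrib[symmetric])
  moreover have "Gamma (\<gamma> + 1) = \<gamma> * Gamma \<gamma>"
    using \<open>0 < \<gamma>\<close> by (intro Gamma_plus1) (auto elim!: nonpos_Ints_cases)
  ultimately show ?thesis by (simp add: T_def)
qed

text \<open>
  For \<open>\<beta> < 1\<close>, let \<open>h\<close> tend to \<open>0\<close> in the bound for difference quotients; the local saving comes
  from continuity of \<open>y\<close> at \<open>t\<close>, where \<open>\<bar>y t\<bar> < M\<close>.  Estimating difference quotients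
  avoids differentiation under the integral sign, which the singular kernel makes delicate.  For \<open>\<beta> = 1\<close> the
  claim is the hypothesis \<open>\<bar>y t\<bar> < M\<close> itself.
\<close>

lemma RL_derivative_bound:
  fixes x y :: "real \<Rightarrow> real"
  assumes \<beta>: "0 < \<beta>" "\<beta> \<le> 1" and t: "t \<in> {a<..<b}"
    and dx: "\<And>s. s \<in> {a..b} \<Longrightarrow> (x has_real_derivative y s) (at s within {a..b})"
    and cont: "continuous_on {a..b} y"
    and bound: "\<And>s. s \<in> {a..b} \<Longrightarrow> \<bar>y s\<bar> \<le> M"
    and less: "\<bar>y t\<bar> < M" and "x a = 0"
    and ex: "RL_derivative_exists \<beta> a x t"
  shows "\<bar>RL_derivative \<beta> a x t\<bar> < M * ((t - a) powr (1 - \<beta>) / Gamma (2 - \<beta>))"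
proof -
  have n: "nat \<lceil>\<beta>\<rceil> = 1"
    using ceiling_unique[of 1 \<beta>] \<beta> by simp
  define F where "F = RL_integral (1 - \<beta>) a x"
  have D: "RL_derivative \<beta> a x t = deriv F t"
    by (simp add: RL_derivative_def n F_def)
  show ?thesis
  proof (cases "\<beta> = 1")
    case True
    have "(x has_real_derivative y t) (at t)"
      using dx[of t] t by (simp add: at_within_Icc_at)
    moreover have "F = x"
      by (auto simp: F_def RL_integral_def True)
    ultimately show ?thesis
      using less t by (simp add: D DERIV_imp_deriv) (simp add: True)
  next
    case False
    define \<gamma> where "\<gamma> = 1 - \<beta>"
    have \<gamma>: "0 < \<gamma>" using False \<beta> by (simp add: \<gamma>_def)
    have ex_int: "\<forall>\<^sub>F s in nhds t. RL_integral_exists \<gamma> a x s"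
      and dF: "(F has_real_derivative deriv F t) (at t)"
      using ex by (simp_all add: RL_derivative_exists_def n \<gamma>_def F_def DERIV_deriv_iff_field_differentiable)
    \<comment> \<open>Half of the gap at \<open>t\<close>, so that \<open>\<bar>y\<bar> < M - \<epsilon>\<close> persists in a neighbourhood.\<close>
    define \<epsilon> where "\<epsilon> = (M - \<bar>y t\<bar>) / 2"
    have \<epsilon>: "0 < \<epsilon>" using less by (simp add: \<epsilon>_def)
    have M: "0 \<le> M" using less by simp
    have "isCont y t"
      using cont t by (simp add: continuous_on_interior)
    then have "\<forall>\<^sub>F s in nhds t. \<bar>y s\<bar> < M - \<epsilon>"
      using less unfolding isCont_def tendsto_at_iff_tendsto_nhds
      by (intro order_tendstoD(2)[OF tendsto_rabs]) (auto simp: \<epsilon>_def field_simps)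
    then obtain d where d: "d > 0" "\<And>s. dist s t < d \<Longrightarrow> \<bar>y s\<bar> < M - \<epsilon>"
      by (auto simp: eventually_nhds_metric)
    define \<delta> where "\<delta> = min (d / 2) (min (t - a) (b - t))"
    have \<delta>: "0 < \<delta>" "\<delta> < d" "a \<le> t - \<delta>" "t + \<delta> \<le> b"
      using d t by (auto simp: \<delta>_def)
    have lip: "\<bar>x r - x s\<bar> \<le> M * \<bar>r - s\<bar>" if "r \<in> {a..b}" "s \<in> {a..b}" for r s
      using field_differentiable_bound[of "{a..b}" x y M r s] dx bound that by simp
    have lip_near: "\<bar>x r - x s\<bar> \<le> (M - \<epsilon>) * \<bar>r - s\<bar>"
      if "r \<in> {t-\<delta>..t+\<delta>}" "s \<in> {t-\<delta>..t+\<delta>}" for r s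
    proof -
      have "(x has_real_derivative y v) (at v within {t-\<delta>..t+\<delta>})" if "v \<in> {t-\<delta>..t+\<delta>}" for v
        using that \<delta> by (intro has_field_derivative_subset[OF dx]) auto
      moreover have "\<bar>y v\<bar> \<le> M - \<epsilon>" if "v \<in> {t-\<delta>..t+\<delta>}" for v
        using that \<delta> by (intro less_imp_le d(2)) (auto simp: dist_real_def)
      ultimately show ?thesis
        using field_differentiable_bound[of "{t-\<delta>..t+\<delta>}" x y "M - \<epsilon>" r s] that by simp
    qed
    have shift: "((\<lambda>h. t + h) \<longlongrightarrow> t) (at_right 0)"
      by (auto intro!: tendsto_eq_intros)
    have "\<forall>\<^sub>F h in at_right 0. RL_integral_exists \<gamma> a x (t + h)"
      using eventually_compose_filterlim[OF ex_int shift] .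
    moreover have "\<forall>\<^sub>F h in at_right 0. h \<in> {0<..<\<delta>}"
      using \<delta> by (intro eventually_at_right_real)
    ultimately have ev: "\<forall>\<^sub>F h in at_right 0.
        \<bar>(F (t + h) - F t) / h\<bar> \<le> (M * (t + h - a) powr \<gamma> - \<epsilon> * \<delta> powr \<gamma>) / Gamma (\<gamma> + 1)"
    proof eventually_elim
      case (elim h)
      show ?case
        unfolding F_def \<gamma>_def[symmetric]
        using elim \<delta> \<gamma> M \<open>x a = 0\<close> eventually_nhds_x_imp_x[OF ex_int]
        by (intro difference_quotient_RL_integral_le[where b = b and \<delta> = \<delta>] lip lip_near) auto
    qed
    have "((\<lambda>h. (F (t + h) - F t) / h) \<longlongrightarrow> deriv F t) (at_right 0)"
      using dF unfolding DERIV_def by (rule filterlim_mono) (auto simp: at_le)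
    then have lim: "((\<lambda>h. \<bar>(F (t + h) - F t) / h\<bar>) \<longlongrightarrow> \<bar>deriv F t\<bar>) (at_right 0)"
      by (rule tendsto_rabs)
    have Gamma_pos: "0 < Gamma (\<gamma> + 1)" using \<gamma> by (intro Gamma_real_pos) auto
    have "((\<lambda>h. (M * (t + h - a) powr \<gamma> - \<epsilon> * \<delta> powr \<gamma>) / Gamma (\<gamma> + 1)) \<longlongrightarrow>
        (M * (t + 0 - a) powr \<gamma> - \<epsilon> * \<delta> powr \<gamma>) / Gamma (\<gamma> + 1)) (at_right 0)"
      using t Gamma_pos by (intro tendsto_intros) auto
    then have "\<bar>deriv F t\<bar> \<le> (M * (t + 0 - a) powr \<gamma> - \<epsilon> * \<delta> powr \<gamma>) / Gamma (\<gamma> + 1)"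
      using lim ev by (rule tendsto_le[rotated]) simp
    also have "\<dots> < M * (t - a) powr \<gamma> / Gamma (\<gamma> + 1)"
      using Gamma_pos \<epsilon> \<delta> by (intro divide_strict_right_mono) auto
    finally show ?thesis by (simp add: D \<gamma>_def)
  qed
qed

section \<open>The Lyapunov-type inequality\<close>

theorem theorem3p1:
  fixes a b \<beta> :: real and f g x :: "real \<Rightarrow> real"
  assumes "a < b"
    and "0 < \<beta>" and "\<beta> \<le> 1"
    and "continuous_on {a..b} f" and "continuous_on {a..b} g"
    and "C_on 2 {a..b} x"
    and "\<And>t. t \<in> {a<..<b} \<Longrightarrow> RL_derivative_exists \<beta> a x t"
    and "\<And>t. t \<in> {a<..<b} \<Longrightarrow>
           (deriv ^^ 2) x t + g t * RL_derivative \<beta> a x t + f t * x t = 0"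
    and "x a = 0" and "x b = 0"
    and "\<And>t. t \<in> {a<..<b} \<Longrightarrow> x t \<noteq> 0"
  shows "b - a <
    max (integral {a..b} (\<lambda>s. (s - a) powr (2 - \<beta>) / Gamma (2 - \<beta>) * \<bar>g s\<bar>))
        (integral {a..b} (\<lambda>s. (s - a) powr (1 - \<beta>) / Gamma (2 - \<beta>) * (b - s) * \<bar>g s\<bar>))
    + integral {a..b} (\<lambda>s. (s - a) * (b - s) * \<bar>f s\<bar>)"
proof -
  have "\<exists>y z. (\<forall>t\<in>{a..b}. (x has_real_derivative y t) (at t within {a..b})) \<and>
      (\<forall>t\<in>{a..b}. (y has_real_derivative z t) (at t within {a..b})) \<and> continuous_on {a..b} z"
    using \<open>C_on 2 {a..b} x\<close> unfolding numeral_2_eq_2 C_on.simps by blast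
  then obtain y z where
    dx: "\<And>t. t \<in> {a..b} \<Longrightarrow> (x has_real_derivative y t) (at t within {a..b})" and
    dy: "\<And>t. t \<in> {a..b} \<Longrightarrow> (y has_real_derivative z t) (at t within {a..b})" and
    cz: "continuous_on {a..b} z"
    by blast
  have cy: "continuous_on {a..b} y"
    using dy by (intro DERIV_continuous_on)
  have dx_in: "(x has_real_derivative y t) (at t)" and dy_in: "(y has_real_derivative z t) (at t)"
    if "t \<in> {a<..<b}" for t
    using dx[of t] dy[of t] that by (simp_all add: at_within_Icc_at)
  have z: "(deriv ^^ 2) x t = z t" if t: "t \<in> {a<..<b}" for t
  proof -
    have "\<forall>\<^sub>F s in nhds t. s \<in> {a<..<b}"
      using t by (intro eventually_nhds_in_open) auto
    then have "\<forall>\<^sub>F s in nhds t. deriv x s = y s"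
      by eventually_elim (rule DERIV_imp_deriv[OF dx_in])
    then have "deriv (deriv x) t = deriv y t"
      by (rule deriv_cong_ev) simp
    then show ?thesis
      by (simp add: numeral_2_eq_2 DERIV_imp_deriv[OF dy_in[OF t]])
  qed
  obtain t where t: "t \<in> {a..b}" and t_max: "\<And>s. s \<in> {a..b} \<Longrightarrow> \<bar>y s\<bar> \<le> \<bar>y t\<bar>"
    using continuous_attains_sup[OF compact_Icc _ continuous_on_rabs[OF cy]] \<open>a < b\<close> by auto
  define M where "M = \<bar>y t\<bar>"
  have bound: "\<bar>y s\<bar> \<le> M" if "s \<in> {a..b}" for s
    using t_max that by (simp add: M_def)
  have "0 < M"
  proof (rule ccontr)
    assume "\<not> 0 < M"
    \<comment> \<open>With slope zero everywhere, \<open>x\<close> would vanish at the midpoint.\<close>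
    then have "M = 0" by (simp add: M_def)
    have "\<bar>x ((a + b) / 2) - x a\<bar> \<le> M * \<bar>(a + b) / 2 - a\<bar>"
      using field_differentiable_bound[of "{a..b}" x y M "(a + b) / 2" a] dx bound \<open>a < b\<close> by simp
    then show False
      using assms(11)[of "(a + b) / 2"] \<open>x a = 0\<close> \<open>a < b\<close> \<open>M = 0\<close> by simp
  qed
  \<comment> \<open>Here \<open>0 powr 0 = 0\<close>, so for \<open>\<beta> = 1\<close> the weight \<open>(s - a) powr (1 - \<beta>)\<close> jumps at \<open>s = a\<close>.
      Its continuous version differs from it only at this point.\<close>
  define k where "k = (\<lambda>s. if \<beta> = 1 then 1 else (s - a) powr (1 - \<beta>) / Gamma (2 - \<beta>))"
  have k_eq: "k s = (s - a) powr (1 - \<beta>) / Gamma (2 - \<beta>)" if "a < s" for s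
    using that by (auto simp: k_def)
  have Gamma_pos: "0 < Gamma (2 - \<beta>)"
    using \<open>\<beta> \<le> 1\<close> by (intro Gamma_real_pos) auto
  have k_nonneg: "0 \<le> k s" for s
    using Gamma_pos by (simp add: k_def)
  have ck: "continuous_on {a..b} k"
  proof (cases "\<beta> = 1")
    case False
    then show ?thesis
      using \<open>\<beta> \<le> 1\<close> less_imp_neq[OF Gamma_pos, symmetric] unfolding k_def
      by (auto intro!: continuous_intros continuous_on_powr')
  qed (simp add: k_def)
  have strict: "\<bar>z s\<bar> < M * (k s * \<bar>g s\<bar> + \<bar>f s\<bar> * L)"
    if s: "s \<in> {a<..<b}" and "z s \<noteq> 0" and L: "\<bar>x s\<bar> < M * L" and y_less: "\<bar>y s\<bar> < M" for s L
  proof -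
    have D: "\<bar>RL_derivative \<beta> a x s\<bar> < M * k s"
      using RL_derivative_bound[of \<beta> s a b x y M] assms s dx cy bound y_less by (simp add: k_eq)
    have eq: "z s = - (g s * RL_derivative \<beta> a x s + f s * x s)"
      using assms(8)[OF s] z[OF s] by simp
    have le: "\<bar>z s\<bar> \<le> \<bar>g s\<bar> * \<bar>RL_derivative \<beta> a x s\<bar> + \<bar>f s\<bar> * \<bar>x s\<bar>"
      unfolding eq abs_minus_cancel abs_mult[symmetric] by (rule abs_triangle_ineq)
    \<comment> \<open>A nonzero coefficient is needed for a strict bound to stay strict after multiplication.\<close>
    have "g s \<noteq> 0 \<or> f s \<noteq> 0"
      using eq \<open>z s \<noteq> 0\<close> by auto
    then have "\<bar>g s\<bar> * \<bar>RL_derivative \<beta> a x s\<bar> + \<bar>f s\<bar> * \<bar>x s\<bar> < \<bar>g s\<bar> * (M * k s) + \<bar>f s\<bar> * (M * L)"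
    proof
      assume "g s \<noteq> 0"
      then show ?thesis
        using D L by (intro add_less_le_mono mult_strict_left_mono mult_left_mono) auto
    next
      assume "f s \<noteq> 0"
      then show ?thesis
        using D L by (intro add_le_less_mono mult_strict_left_mono mult_left_mono) auto
    qed
    with le show ?thesis by (simp add: algebra_simps)
  qed
  have y_less: "\<bar>y s\<bar> < M" if "s \<in> {a<..<b}" "z s \<noteq> 0" for s
    using derivative_eq_zero_at_interior_abs_max[OF dy_in, of s a b M] that bound[of s] bound \<open>0 < M\<close>
    by fastforce
  note incr = increment_less_of_derivative_less[OF dx cy bound]
  have "b - a < max (integral {a..b} (\<lambda>s. (s - a) * (k s * \<bar>g s\<bar>)))
        (integral {a..b} (\<lambda>s. (b - s) * (k s * \<bar>g s\<bar>)))
      + integral {a..b} (\<lambda>s. (s - a) * (b - s) * \<bar>f s\<bar>)"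
  proof (rule interval_length_less_of_curvature_bound[OF \<open>a < b\<close> dx dy cz])
    show "\<bar>y t\<bar> = M" by (simp add: M_def)
    fix s assume s: "s \<in> {a<..<b}" and "z s \<noteq> 0"
    show "\<bar>z s\<bar> < M * (k s * \<bar>g s\<bar> + \<bar>f s\<bar> * (s - a))"
      using incr[of a s s] s y_less[OF s \<open>z s \<noteq> 0\<close>] \<open>x a = 0\<close> \<open>z s \<noteq> 0\<close> by (intro strict) auto
    show "\<bar>z s\<bar> < M * (k s * \<bar>g s\<bar> + \<bar>f s\<bar> * (b - s))"
      using incr[of s b s] s y_less[OF s \<open>z s \<noteq> 0\<close>] \<open>x b = 0\<close> \<open>z s \<noteq> 0\<close> by (intro strict) auto
  qed (use assms t ck k_nonneg \<open>0 < M\<close> in \<open>auto intro!: continuous_intros\<close>)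
  also have "integral {a..b} (\<lambda>s. (s - a) * (k s * \<bar>g s\<bar>))
      = integral {a..b} (\<lambda>s. (s - a) powr (2 - \<beta>) / Gamma (2 - \<beta>) * \<bar>g s\<bar>)"
  proof (rule integral_spike[of "{a}"])
    fix s assume "s \<in> {a..b} - {a}"
    then have "a < s" by auto
    then have "(s - a) powr (2 - \<beta>) = (s - a) * (s - a) powr (1 - \<beta>)"
      using powr_add[of "s - a" 1 "1 - \<beta>"] by simp
    then show "(s - a) powr (2 - \<beta>) / Gamma (2 - \<beta>) * \<bar>g s\<bar> = (s - a) * (k s * \<bar>g s\<bar>)"
      using \<open>a < s\<close> by (simp add: k_eq)
  qed simp
  also have "integral {a..b} (\<lambda>s. (b - s) * (k s * \<bar>g s\<bar>))
      = integral {a..b} (\<lambda>s. (s - a) powr (1 - \<beta>) / Gamma (2 - \<beta>) * (b - s) * \<bar>g s\<bar>)"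
    by (rule integral_spike[of "{a}"]) (auto simp: k_eq)
  finally show ?thesis .
qed

end
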